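(* Let $G$ be a finite connected multigraph and let $D_1,\dots,D_k$ be divisors on $G$. Then the Poincar\'e series $$P_{G,D_1,\dots,D_k}(z_1,\dots,z_k)=\sum_{(n_1,\dots,n_k)\in\mathbb{N}^k}\bigl(r_G(n_1D_1+\dots+n_kD_k)+1\bigr)z_1^{n_1}\cdots z_k^{n_k}$$ is rational: there exist polynomials $f,h\in\mathbb{Z}[z_1,\dots,z_k]$ such that $P_{G,D_1,\dots,D_k}(z_1,\dots,z_k)=f(z_1,\dots,z_k)/h(z_1,\dots,z_k)$ at every $(z_1,\dots,z_k)\in\mathbb{C}^k$ at which the series converges absolutely.
   Context: $\mathbb{N}$ denotes the set of non-negative integers. For a finite connected multigraph $G$ with vertex set $V(G)$, a divisor is an element $\sum_{u\in V(G)}a_u(u)$ of the free Abelian group ${\rm Div}(G)$ on $V(G)$; its degree is $\sum_u a_u$, and it is effective if all $a_u\ge 0$. For $f:V(G)\to\mathbb{Z}$, the principal divisor ${\rm div}(f)=\sum_{u}\bigl(\sum_{e=(u,v)\in E(G)}(f(u)-f(v))\bigr)(u)$ (sum over edges incident to $u$, with multiplicity). Two divisors are linearly equivalent if their difference is principal. The linear system $|D|$ is the set of effective divisors linearly equivalent to $D$. The rank $r_G(D)$ is $-1$ if $|D|=\emptyset$, and otherwise the largest integer $r$ such that $|D-E|\neq\emptyset$ for every effective divisor $E$ of degree $r$. *)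

theory Defs
  imports
    "HOL-Analysis.Analysis"
    "HOL-Algebra.Free_Abelian_Groups"
    "Graph_Theory.Digraph_Component"
    "Graph_Theory.Bidirected_Digraph"
begin

text \<open>
  An undirected edge joining \<open>u\<close> and \<open>v\<close> is a pair of mutually reverse arcs, matched by the
  involution \<open>arev\<close> (so that both directions have the same multiplicity; this is not
  guaranteed by \<^locale>\<open>pseudo_graph\<close>). Parallel edges are allowed; so are loops, which
  contribute nothing to principal divisors.
\<close>

locale finite_connected_multigraph = fin_digraph G + bidirected_digraph G arev
  for G :: "('v, 'e) pre_digraph" and arev :: "'e \<Rightarrow> 'e" +
  assumes connected_G: "Digraph_Component.connected G"

definition divisors :: "('v, 'e) pre_digraph \<Rightarrow> ('v \<Rightarrow>\<^sub>0 int) set" where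
  "divisors G = carrier (free_Abelian_group (verts G))"

definition divisor_degree :: "('v \<Rightarrow>\<^sub>0 int) \<Rightarrow> int" where
  "divisor_degree D = (\<Sum>u\<in>Poly_Mapping.keys D. Poly_Mapping.lookup D u)"

definition effective :: "('v \<Rightarrow>\<^sub>0 int) \<Rightarrow> bool" where
  "effective D \<longleftrightarrow> (\<forall>u. 0 \<le> Poly_Mapping.lookup D u)"

text \<open>
  Each edge incident to \<open>u\<close> is represented by exactly one arc with tail \<open>u\<close> (for a loop, by two
  such arcs, whose terms vanish). Only the values of \<open>f\<close> on the vertices of \<open>G\<close> matter.
\<close>

definition principal_divisor :: "('v, 'e) pre_digraph \<Rightarrow> ('v \<Rightarrow> int) \<Rightarrow> 'v \<Rightarrow>\<^sub>0 int" where
  "principal_divisor G f =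
     (\<Sum>u\<in>verts G. Poly_Mapping.single u (\<Sum>e\<in>out_arcs G u. f u - f (head G e)))"

definition linearly_equivalent ::
    "('v, 'e) pre_digraph \<Rightarrow> ('v \<Rightarrow>\<^sub>0 int) \<Rightarrow> ('v \<Rightarrow>\<^sub>0 int) \<Rightarrow> bool" where
  "linearly_equivalent G D D' \<longleftrightarrow> (\<exists>f. D - D' = principal_divisor G f)"

definition linear_system ::
    "('v, 'e) pre_digraph \<Rightarrow> ('v \<Rightarrow>\<^sub>0 int) \<Rightarrow> ('v \<Rightarrow>\<^sub>0 int) set" where
  "linear_system G D = {D' \<in> divisors G. effective D' \<and> linearly_equivalent G D' D}"

text \<open>
  If \<^term>\<open>linear_system G D\<close> is nonempty, the set of admissible \<open>r\<close> below contains \<open>0\<close> and is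
  bounded above by the degree of \<open>D\<close>, so the greatest element exists.
\<close>

definition divisor_rank :: "('v, 'e) pre_digraph \<Rightarrow> ('v \<Rightarrow>\<^sub>0 int) \<Rightarrow> int" where
  "divisor_rank G D =
     (if linear_system G D = {} then - 1
      else (GREATEST r. \<forall>E\<in>divisors G. effective E \<and> divisor_degree E = r \<longrightarrow>
              linear_system G (D - E) \<noteq> {}))"

definition poincare_term ::
    "('v, 'e) pre_digraph \<Rightarrow> ('k::finite \<Rightarrow> ('v \<Rightarrow>\<^sub>0 int)) \<Rightarrow> complex ^ 'k \<Rightarrow> ('k \<Rightarrow> nat) \<Rightarrow> complex" where
  "poincare_term G D z n =
     of_int (divisor_rank G (\<Sum>i\<in>UNIV. frag_cmul (int (n i)) (D i)) + 1) * (\<Prod>i\<in>UNIV. (z $ i) ^ n i)"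

definition poincare_series ::
    "('v, 'e) pre_digraph \<Rightarrow> ('k::finite \<Rightarrow> ('v \<Rightarrow>\<^sub>0 int)) \<Rightarrow> complex ^ 'k \<Rightarrow> complex" where
  "poincare_series G D z = (\<Sum>\<^sub>\<infinity>n. poincare_term G D z n)"

text \<open>
  An integer polynomial in variables indexed by \<open>'k\<close> maps exponent vectors to coefficients.
\<close>

type_synonym 'k int_mpoly = "('k \<Rightarrow>\<^sub>0 nat) \<Rightarrow>\<^sub>0 int"

definition eval_int_mpoly :: "'k::finite int_mpoly \<Rightarrow> complex ^ 'k \<Rightarrow> complex" where
  "eval_int_mpoly p z =
     (\<Sum>m\<in>Poly_Mapping.keys p.
        of_int (Poly_Mapping.lookup p m) * (\<Prod>i\<in>UNIV. (z $ i) ^ Poly_Mapping.lookup m i))"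

end

theory Submission
  imports Defs
begin

text \<open>
  The Jacobian is finite, say of exponent dividing \<open>N\<close>: every class has a representative with
  bounded Laplacian, and the kernel of the Laplacian consists of the constants. Hence the rank of
  \<open>X\<close> depends only on the degree and on finitely many residue classes. It is \<open>-1\<close> in negative
  degree, and in large degree adding a vertex \<open>q\<close> raises it by exactly 1, because along
  \<open>X + t q\<close> the difference of degree and rank is monotone and bounded; the Riemann-Roch theorem
  is not needed.

  Write \<open>\<phi> n\<close> for the coefficient at \<open>n\<close> and \<open>d\<^sub>i\<close> for the degree of \<open>D\<^sub>i\<close>. Then \<open>\<phi>\<close> is
  invariant under translation by \<open>u\<close> with \<open>N\<close> dividing \<open>u\<close> and \<open>d(u) = 0\<close>, such as
  \<open>u = N(-d\<^sub>j e\<^sub>i + d\<^sub>i e\<^sub>j)\<close> for \<open>d\<^sub>i > 0 > d\<^sub>j\<close>, and eventually affine along \<open>N e\<^sub>i\<close> for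
  \<open>d\<^sub>i > 0\<close>. Multiplying the series over an orthant by \<open>(1 - z\<^sup>u)\<^sup>2\<close> therefore leaves series over
  orthants of smaller dimension, and induction applies. Since \<open>\<phi>\<close> does not vanish at large
  multiples of \<open>u\<close>, absolute convergence at \<open>z\<close> forces \<open>z\<^sup>u \<noteq> 1\<close>, so no denominator vanishes.
\<close>

section \<open>Rational functions and series over orthants\<close>

definition monomial_at :: "complex ^ 'k::finite \<Rightarrow> ('k \<Rightarrow> nat) \<Rightarrow> complex" where
  "monomial_at z n = (\<Prod>i\<in>UNIV. (z $ i) ^ n i)"

lemma monomial_at_add:
  "monomial_at z (\<lambda>i. m i + n i) = monomial_at z m * monomial_at z n"
  by (simp add: monomial_at_def power_add prod.distrib)

lemma monomial_at_mult:
  "monomial_at z (\<lambda>i. j * n i) = monomial_at z n ^ j"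
  by (simp add: monomial_at_def power_mult prod_power_distrib mult.commute[of j])

lemma eval_int_mpoly_superset:
  assumes "finite S" "Poly_Mapping.keys p \<subseteq> S"
  shows "eval_int_mpoly p z =
    (\<Sum>m\<in>S. of_int (Poly_Mapping.lookup p m) * monomial_at z (Poly_Mapping.lookup m))"
  unfolding eval_int_mpoly_def monomial_at_def
  using assms by (intro sum.mono_neutral_left) (auto simp: in_keys_iff)

lemma eval_int_mpoly_add: "eval_int_mpoly (p + q) z = eval_int_mpoly p z + eval_int_mpoly q z"
proof -
  let ?S = "Poly_Mapping.keys p \<union> Poly_Mapping.keys q"
  have "Poly_Mapping.keys (p + q) \<subseteq> ?S" by (rule keys_add)
  then show ?thesis
    by (simp add: eval_int_mpoly_superset[of ?S] lookup_add distrib_right sum.distrib)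
qed

lemma eval_int_mpoly_zero [simp]: "eval_int_mpoly 0 z = 0"
  by (simp add: eval_int_mpoly_def)

lemma eval_int_mpoly_single:
  "eval_int_mpoly (Poly_Mapping.single m c) z = of_int c * monomial_at z (Poly_Mapping.lookup m)"
  by (subst eval_int_mpoly_superset[of "{m}"]) (auto simp: keys_single)

text \<open>Both sides are additive in each factor, so induction over the free Abelian group on the
  exponent vectors leaves only the case of two monomials, whose exponents add.\<close>

lemma eval_int_mpoly_mult: "eval_int_mpoly (p * q) z = eval_int_mpoly p z * eval_int_mpoly q z"
proof -
  \<comment> \<open>The induction rule closes under differences, not sums.\<close>
  have diff: "eval_int_mpoly (f - g) z = eval_int_mpoly f z - eval_int_mpoly g z" for f g :: "'a int_mpoly"
    using eval_int_mpoly_add[of "f - g" g z] by simp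
  have single: "eval_int_mpoly (frag_of m * q) z = eval_int_mpoly (frag_of m) z * eval_int_mpoly q z" for m
    using subset_UNIV
  proof (induction q rule: frag_induction)
    case (one k)
    then show ?case
      by (simp add: mult_single eval_int_mpoly_single plus_poly_mapping.rep_eq monomial_at_add)
  qed (simp_all add: right_diff_distrib diff)
  show ?thesis
    using subset_UNIV
    by (induction p rule: frag_induction) (simp_all add: single left_diff_distrib diff)
qed

section \<open>Quotients of integer polynomials without poles on a set\<close>

text \<open>One pair of polynomials has to serve all of \<open>Z\<close>. Poles are excluded
  explicitly, since division by zero yields 0 and would hide them.\<close>

definition rational_on :: "(complex ^ 'k::finite) set \<Rightarrow> (complex ^ 'k \<Rightarrow> complex) \<Rightarrow> bool" where
  "rational_on Z F \<longleftrightarrow> (\<exists>f h. \<forall>z\<in>Z. eval_int_mpoly h z \<noteq> 0 \<and>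
     F z = eval_int_mpoly f z / eval_int_mpoly h z)"

lemma rational_on_cong:
  assumes "rational_on Z F" "\<And>z. z \<in> Z \<Longrightarrow> F z = G z"
  shows "rational_on Z G"
  using assms unfolding rational_on_def by metis

lemma rational_on_monomial: "rational_on Z (\<lambda>z. of_int c * monomial_at z n)"
proof -
  \<comment> \<open>The index type is finite, so every \<open>n\<close> has finite support and is an
    exponent vector.\<close>
  have n: "Poly_Mapping.lookup (Abs_poly_mapping n) = n"
    by (simp add: Abs_poly_mapping_inverse)
  have one: "eval_int_mpoly (Poly_Mapping.single 0 1) z = 1" for z :: "complex ^ 'a"
    unfolding eval_int_mpoly_single by (simp add: monomial_at_def)
  show ?thesis
    unfolding rational_on_def
    by (rule exI[of _ "Poly_Mapping.single (Abs_poly_mapping n) c"],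
        rule exI[of _ "Poly_Mapping.single 0 1"])
      (simp add: one eval_int_mpoly_single n monomial_at_def del: single_one)
qed

lemma rational_on_const: "rational_on Z (\<lambda>_. of_int c)"
  using rational_on_monomial[of Z c "\<lambda>_. 0"] by (simp add: monomial_at_def)

lemma rational_on_mult:
  assumes "rational_on Z F" "rational_on Z G"
  shows "rational_on Z (\<lambda>z. F z * G z)"
proof -
  obtain f h f' h' where
    "\<forall>z\<in>Z. eval_int_mpoly h z \<noteq> 0 \<and> F z = eval_int_mpoly f z / eval_int_mpoly h z"
    "\<forall>z\<in>Z. eval_int_mpoly h' z \<noteq> 0 \<and> G z = eval_int_mpoly f' z / eval_int_mpoly h' z"
    using assms unfolding rational_on_def by blast
  then show ?thesis
    unfolding rational_on_def
    by (intro exI[of _ "f * f'"] exI[of _ "h * h'"]) (auto simp: eval_int_mpoly_mult)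
qed

lemma rational_on_add:
  assumes "rational_on Z F" "rational_on Z G"
  shows "rational_on Z (\<lambda>z. F z + G z)"
proof -
  obtain f h f' h' where
    "\<forall>z\<in>Z. eval_int_mpoly h z \<noteq> 0 \<and> F z = eval_int_mpoly f z / eval_int_mpoly h z"
    "\<forall>z\<in>Z. eval_int_mpoly h' z \<noteq> 0 \<and> G z = eval_int_mpoly f' z / eval_int_mpoly h' z"
    using assms unfolding rational_on_def by blast
  then show ?thesis
    unfolding rational_on_def
    by (intro exI[of _ "f * h' + f' * h"] exI[of _ "h * h'"])
      (auto simp: eval_int_mpoly_mult eval_int_mpoly_add add_frac_eq)
qed

lemma rational_on_diff:
  assumes "rational_on Z F" "rational_on Z G"
  shows "rational_on Z (\<lambda>z. F z - G z)"
  using rational_on_add[OF assms(1) rational_on_mult[OF rational_on_const[of Z "-1"] assms(2)]]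
  by simp

text \<open>Where \<open>F\<close> has no zero, neither has its numerator, so numerator and
  denominator may be exchanged.\<close>

lemma rational_on_inverse:
  assumes "rational_on Z F" "\<And>z. z \<in> Z \<Longrightarrow> F z \<noteq> 0"
  shows "rational_on Z (\<lambda>z. inverse (F z))"
proof -
  obtain f h where
    fh: "\<forall>z\<in>Z. eval_int_mpoly h z \<noteq> 0 \<and> F z = eval_int_mpoly f z / eval_int_mpoly h z"
    using assms unfolding rational_on_def by blast
  with assms(2) have "\<forall>z\<in>Z. eval_int_mpoly f z \<noteq> 0" by fastforce
  with fh show ?thesis
    unfolding rational_on_def
    by (intro exI[of _ h] exI[of _ f]) auto
qed

section \<open>Orthants of exponent vectors\<close>

text \<open>The coordinates in \<open>I\<close> are free, the others are frozen at \<open>a\<close>.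
  The size of \<open>I\<close> is the dimension on which the main induction runs.\<close>

definition orthant :: "'k set \<Rightarrow> ('k \<Rightarrow> nat) \<Rightarrow> ('k \<Rightarrow> nat) set" where
  "orthant I a = {n. (\<forall>i\<in>I. a i \<le> n i) \<and> (\<forall>i. i \<notin> I \<longrightarrow> n i = a i)}"

lemma orthant_empty: "orthant {} a = {a}"
  by (auto simp: orthant_def)

lemma orthant_split:
  assumes "i \<in> I"
  shows "orthant I a = orthant (I - {i}) a \<union> orthant I (a(i := Suc (a i)))"
    and "orthant (I - {i}) a \<inter> orthant I (a(i := Suc (a i))) = {}"
  using assms
  by (fastforce simp: orthant_def not_less_eq_eq split: if_splits)+

lemma orthant_shift:
  assumes "\<And>i. i \<notin> I \<Longrightarrow> u i = 0"
  shows "orthant I (\<lambda>i. a i + u i) = (\<lambda>n i. n i + u i) ` orthant I a"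
proof (intro equalityI subsetI)
  fix n assume n: "n \<in> orthant I (\<lambda>i. a i + u i)"
  then have "a i + u i \<le> n i" for i
    using assms by (cases "i \<in> I") (auto simp: orthant_def)
  moreover from this have "u i \<le> n i" for i
    using add_leD2 by blast
  \<comment> \<open>Truncated subtraction is exact here because
    \<open>u i \<le> n i\<close>.\<close>
  ultimately have "n = (\<lambda>i. (n i - u i) + u i)" "(\<lambda>i. n i - u i) \<in> orthant I a"
    using n assms by (auto simp: orthant_def le_diff_conv2)
  then show "n \<in> (\<lambda>n i. n i + u i) ` orthant I a"
    unfolding image_iff by (rule bexI)
qed (use assms in \<open>auto simp: orthant_def\<close>)

section \<open>Series with coefficients eventually linear in the degree\<close>

text \<open>Separates the summation argument from graphs: \<open>\<phi> n\<close> stands for rank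
  plus one, \<open>d i\<close> for the degree of the i-th divisor, \<open>N\<close> for an exponent
  of the Jacobian and \<open>C\<close> for a bound beyond which the rank grows linearly. The
  assumptions \<open>zero\<close> and \<open>positive\<close> serve to exclude poles.\<close>

locale quasilinear_series =
  fixes \<phi> :: "('k::finite \<Rightarrow> nat) \<Rightarrow> int" and d :: "'k \<Rightarrow> int" and N :: nat and C :: int
  assumes N_pos: "N > 0"
    and zero: "\<phi> (\<lambda>_. 0) \<noteq> 0"
    and negative: "(\<Sum>i\<in>UNIV. int (n i) * d i) < 0 \<Longrightarrow> \<phi> n = 0"
    and positive: "C \<le> (\<Sum>i\<in>UNIV. int (n i) * d i) \<Longrightarrow> \<phi> n \<noteq> 0"
    and periodic: "(\<Sum>i\<in>UNIV. int (u i) * d i) = 0 \<Longrightarrow> (\<And>i. N dvd u i) \<Longrightarrow>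
      \<phi> (\<lambda>i. n i + u i) = \<phi> n"
    and linear: "C \<le> (\<Sum>i\<in>UNIV. int (n i) * d i) \<Longrightarrow> 0 \<le> (\<Sum>i\<in>UNIV. int (u i) * d i) \<Longrightarrow>
      (\<And>i. N dvd u i) \<Longrightarrow> \<phi> (\<lambda>i. n i + u i) = \<phi> n + (\<Sum>i\<in>UNIV. int (u i) * d i)"
begin

definition deg :: "('k \<Rightarrow> nat) \<Rightarrow> int" where
  "deg n = (\<Sum>i\<in>UNIV. int (n i) * d i)"

lemma deg_add: "deg (\<lambda>i. m i + n i) = deg m + deg n"
  by (simp add: deg_def distrib_right sum.distrib)

lemma deg_mult: "deg (\<lambda>i. j * n i) = int j * deg n"
  by (simp add: deg_def sum_distrib_left mult.assoc)

lemma deg_unit: "deg ((\<lambda>_. 0)(i := x)) = int x * d i"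
proof -
  have "deg ((\<lambda>_. 0)(i := x)) = (\<Sum>j\<in>UNIV. if j = i then int x * d i else 0)"
    unfolding deg_def by (intro sum.cong) auto
  then show ?thesis by simp
qed

lemma periodic_deg:
  "deg u = 0 \<Longrightarrow> (\<And>i. N dvd u i) \<Longrightarrow> \<phi> (\<lambda>i. n i + u i) = \<phi> n"
  unfolding deg_def by (rule periodic)

lemma linear_deg:
  "C \<le> deg n \<Longrightarrow> 0 \<le> deg u \<Longrightarrow> (\<And>i. N dvd u i) \<Longrightarrow> \<phi> (\<lambda>i. n i + u i) = \<phi> n + deg u"
  unfolding deg_def by (rule linear)

definition summand :: "complex ^ 'k \<Rightarrow> ('k \<Rightarrow> nat) \<Rightarrow> complex" where
  "summand z n = of_int (\<phi> n) * monomial_at z n"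

text \<open>Absolute convergence of the whole series is fixed once, so that all subseries converge
  on the same set.\<close>

definition Z :: "(complex ^ 'k) set" where
  "Z = {z. (\<lambda>n. norm (summand z n)) summable_on UNIV}"

lemma summand_summable: "z \<in> Z \<Longrightarrow> summand z summable_on A"
  unfolding Z_def using abs_summable_summable summable_on_subset_banach by blast

definition partial_series :: "'k set \<Rightarrow> ('k \<Rightarrow> nat) \<Rightarrow> complex ^ 'k \<Rightarrow> complex" where
  "partial_series I a z = (\<Sum>\<^sub>\<infinity>n\<in>orthant I a. summand z n)"

text \<open>
  If \<open>z\<^sup>u = 1\<close>, the summands at the multiples of \<open>u\<close> are nonzero integers.
\<close>

lemma monomial_neq_1:
  assumes "z \<in> Z" "u \<noteq> (\<lambda>_. 0)" and ev: "\<And>j. j \<ge> j0 \<Longrightarrow> \<phi> (\<lambda>i. j * u i) \<noteq> 0"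
  shows "monomial_at z u \<noteq> 1"
proof
  assume 1: "monomial_at z u = 1"
  obtain i where i: "u i > 0" using assms(2) by auto
  let ?h = "\<lambda>j::nat. \<lambda>i. j * u i"
  have inj: "inj ?h"
    using i by (auto simp: inj_def fun_eq_iff)
  have "(\<lambda>n. norm (summand z n)) summable_on range ?h"
    using assms(1) summable_on_subset_banach unfolding Z_def by blast
  then have "((\<lambda>n. norm (summand z n)) \<circ> ?h) summable_on UNIV"
    using summable_on_reindex[OF inj] by blast
  then have "summable ((\<lambda>n. norm (summand z n)) \<circ> ?h)"
    by (rule summable_on_UNIV_nonneg_real_iff[THEN iffD1, rotated]) auto
  \<comment> \<open>The terms tend to 0, yet from \<open>j0\<close> on each is the absolute value of
    a nonzero integer.\<close>
  then have "((\<lambda>n. norm (summand z n)) \<circ> ?h) \<longlonglongrightarrow> 0"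
    by (rule summable_LIMSEQ_zero)
  then have "eventually (\<lambda>j. norm (summand z (?h j)) < 1) sequentially"
    by (auto dest!: order_tendstoD(2)[where a = 1])
  then have "eventually (\<lambda>j. j \<ge> j0 \<and> norm (summand z (?h j)) < 1) sequentially"
    using eventually_ge_at_top by (rule eventually_conj[rotated])
  then obtain j where j: "j \<ge> j0" "norm (summand z (?h j)) < 1"
    by (auto dest: eventually_happens)
  have "norm (summand z (?h j)) = \<bar>real_of_int (\<phi> (?h j))\<bar>"
    using monomial_at_mult[of z j u] 1 by (simp add: summand_def norm_mult)
  moreover have "\<bar>\<phi> (?h j)\<bar> \<ge> 1" using ev[OF j(1)] by linarith
  ultimately show False using j(2) by linarith
qed

text \<open>In degree 0 the multiples of \<open>u\<close> are periods, so \<open>\<phi>\<close>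
  takes its nonzero value at 0 on all of them. In positive degree the multiples eventually have
  degree at least \<open>C\<close>.\<close>

lemma monomial_neq_1_nonneg:
  assumes "z \<in> Z" "u \<noteq> (\<lambda>_. 0)" "0 \<le> deg u" "\<And>i. N dvd u i"
  shows "monomial_at z u \<noteq> 1"
proof (cases "deg u = 0")
  case True
  have "\<phi> (\<lambda>i. j * u i) \<noteq> 0" for j
    using periodic[of "\<lambda>i. j * u i" "\<lambda>_. 0"] True assms(4) deg_mult[of j u] zero
    unfolding deg_def by simp
  then show ?thesis using monomial_neq_1[OF assms(1,2)] by blast
next
  case False
  \<comment> \<open>Each multiple of \<open>u\<close> adds at least 1 to the degree, so
    \<open>C\<close> of them suffice.\<close>
  have "\<phi> (\<lambda>i. j * u i) \<noteq> 0" if "j \<ge> nat C" for j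
  proof (rule positive)
    have "C \<le> int j * 1" using that by simp
    also have "\<dots> \<le> int j * deg u" using False assms(3) by (intro mult_left_mono) auto
    finally show "C \<le> (\<Sum>i\<in>UNIV. int (j * u i) * d i)"
      using deg_mult[of j u] by (simp add: deg_def)
  qed
  then show ?thesis using monomial_neq_1[OF assms(1,2)] by blast
qed

lemma partial_series_split:
  assumes "i \<in> I" "z \<in> Z"
  shows "partial_series I a z = partial_series (I - {i}) a z + partial_series I (a(i := Suc (a i))) z"
  unfolding partial_series_def orthant_split(1)[OF assms(1), of a]
  by (intro infsum_Un_disjoint summand_summable assms orthant_split)

text \<open>Each unit step of the base point in direction \<open>i\<close> removes a series in which
  coordinate \<open>i\<close> is frozen; \<open>smaller\<close> will be the induction
  hypothesis.\<close>

lemma partial_series_peel: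
  assumes "i \<in> I" and smaller: "\<And>a. rational_on Z (partial_series (I - {i}) a)"
  shows "rational_on Z (\<lambda>z. partial_series I a z - partial_series I (a(i := a i + m)) z)"
proof (induction m)
  case 0
  show ?case using rational_on_const[of Z 0] by simp
next
  case (Suc m)
  let ?b = "a(i := a i + m)"
  have "?b(i := Suc (?b i)) = a(i := a i + Suc m)" by simp
  then have "partial_series I ?b z =
      partial_series (I - {i}) ?b z + partial_series I (a(i := a i + Suc m)) z" if "z \<in> Z" for z
    using partial_series_split[OF assms(1) that, of ?b] by (simp only:)
  then show ?case
    by (intro rational_on_cong[OF rational_on_add[OF Suc smaller[of ?b]]])
      (simp del: fun_upd_apply)
qed

text \<open>
  The recurrence gives \<open>(1 - z\<^sup>u)\<^sup>2\<close> times the series in terms of the series over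
  \<open>orthant I a - orthant I (a + u)\<close>, which has fewer free coordinates.
\<close>

lemma partial_series_recurrence:
  assumes supp: "\<And>i. i \<notin> I \<Longrightarrow> u i = 0"
    and rec: "\<And>n. n \<in> orthant I a \<Longrightarrow>
      \<phi> (\<lambda>i. n i + u i + u i) = 2 * \<phi> (\<lambda>i. n i + u i) - \<phi> n"
    and peel: "\<And>a. rational_on Z (\<lambda>z. partial_series I a z - partial_series I (\<lambda>i. a i + u i) z)"
    and neq: "\<And>z. z \<in> Z \<Longrightarrow> monomial_at z u \<noteq> 1"
  shows "rational_on Z (partial_series I a)"
proof -
  define b where "b = (\<lambda>i. a i + u i)"
  define c where "c = (\<lambda>i. b i + u i)"
  let ?w = "\<lambda>z. monomial_at z u"
  let ?S = "\<lambda>a. partial_series I a"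
  have image: "orthant I (\<lambda>i. a i + u i) = (\<lambda>n i. n i + u i) ` orthant I a" for a
    by (rule orthant_shift) (rule supp)
  have shift: "?S (\<lambda>i. a i + u i) z = (\<Sum>\<^sub>\<infinity>n\<in>orthant I a. summand z (\<lambda>i. n i + u i))" for a z
    unfolding partial_series_def image
    by (subst infsum_reindex) (auto simp: inj_on_def fun_eq_iff o_def)
  have shifted_summable: "(\<lambda>n. summand z (\<lambda>i. n i + u i)) summable_on A" if "z \<in> Z" for z A
  proof -
    have "inj_on (\<lambda>n i. n i + u i) A" by (auto simp: inj_on_def fun_eq_iff)
    from summable_on_reindex[OF this, of "summand z"] summand_summable[OF that]
    show ?thesis by (simp add: o_def)
  qed
  \<comment> \<open>The recurrence \<open>rec\<close> for the coefficients, weighted with monomials,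
    relates the series based at \<open>a\<close>, \<open>a + u\<close> and
    \<open>a + 2u\<close>.\<close>
  have eq: "?S c z = 2 * ?w z * ?S b z - ?w z ^ 2 * ?S a z" if z: "z \<in> Z" for z
  proof -
    have "?S c z = (\<Sum>\<^sub>\<infinity>n\<in>orthant I b. summand z (\<lambda>i. n i + u i))"
      by (simp add: c_def shift)
    also have "\<dots> = (\<Sum>\<^sub>\<infinity>n\<in>orthant I a. summand z (\<lambda>i. n i + u i + u i))"
      unfolding b_def image
      by (subst infsum_reindex) (auto simp: inj_on_def fun_eq_iff o_def)
    also have "\<dots> = (\<Sum>\<^sub>\<infinity>n\<in>orthant I a.
        2 * ?w z * summand z (\<lambda>i. n i + u i) + (- (?w z ^ 2)) * summand z n)"
      by (intro infsum_cong)
        (simp add: rec summand_def monomial_at_add power2_eq_square left_diff_distrib)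
    also have "\<dots> = (\<Sum>\<^sub>\<infinity>n\<in>orthant I a. 2 * ?w z * summand z (\<lambda>i. n i + u i)) +
        (\<Sum>\<^sub>\<infinity>n\<in>orthant I a. (- (?w z ^ 2)) * summand z n)"
      by (intro infsum_add summable_on_cmult_right shifted_summable summand_summable z)
    also have "\<dots> = 2 * ?w z * ?S b z - ?w z ^ 2 * ?S a z"
      unfolding infsum_cmult_right' by (simp add: b_def shift partial_series_def[of I a])
    finally show ?thesis .
  qed
  let ?A = "\<lambda>z. ?S a z - ?S b z" and ?B = "\<lambda>z. ?S b z - ?S c z"
  let ?q = "\<lambda>z. inverse (1 - ?w z)"
  have w: "rational_on Z ?w" using rational_on_monomial[of Z 1 u] by simp
  have one: "rational_on Z (\<lambda>_. 1)" using rational_on_const[of Z 1] by simp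
  have q: "rational_on Z ?q"
    by (intro rational_on_inverse rational_on_diff one w) (use neq in force)
  have A: "rational_on Z ?A" and B: "rational_on Z ?B"
    using peel[of a] peel[of b] by (simp_all add: b_def c_def)
  \<comment> \<open>The sum \<open>?A + ?B\<close> telescopes to \<open>?S a - ?S c\<close>.
    Inserting \<open>eq\<close> and subtracting \<open>2 * ?w * ?A\<close> leaves
    \<open>(1 - ?w)^2 * ?S a\<close>.\<close>
  have "rational_on Z (\<lambda>z. (?A z + ?B z - (?w z + ?w z) * ?A z) * (?q z * ?q z))"
    by (intro rational_on_add rational_on_diff rational_on_mult w q A B)
  then show ?thesis
  proof (rule rational_on_cong)
    fix z assume z: "z \<in> Z"
    have "?A z + ?B z - (?w z + ?w z) * ?A z = ?S a z * ((1 - ?w z) * (1 - ?w z))"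
      using eq[OF z] by (simp add: algebra_simps power2_eq_square)
    then have "(?A z + ?B z - (?w z + ?w z) * ?A z) * (?q z * ?q z) =
        ?S a z * ((1 - ?w z) * ?q z) * ((1 - ?w z) * ?q z)"
      by (simp only: mult_ac)
    also have "(1 - ?w z) * ?q z = 1" using neq[OF z] by simp
    finally show "(?A z + ?B z - (?w z + ?w z) * ?A z) * (?q z * ?q z) = ?S a z" by simp
  qed
qed

text \<open>The signs of \<open>d\<close> on \<open>I\<close> select a direction in which
  \<open>\<phi>\<close> is periodic or affine, and either property gives the second-order
  recurrence. If all signs are negative, the series vanishes after a shift of the base
  point.\<close>

lemma partial_series_rational: "rational_on Z (partial_series I a)"
proof (induction "card I" arbitrary: I a rule: less_induct)
  case (less I)
  have smaller: "rational_on Z (partial_series (I - {i}) a)" if "i \<in> I" for i a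
    by (rule less) (simp only: card_Diff1_less that finite_class.finite)
  have peel: "rational_on Z (\<lambda>z. partial_series I a z - partial_series I (a(i := a i + m)) z)"
    if "i \<in> I" for i a m
    by (rule partial_series_peel[OF that smaller[OF that]])
  \<comment> \<open>Covers both uses of the direction \<open>N e_i\<close>: \<open>\<phi>\<close> is
    periodic along it if \<open>d i = 0\<close>, and affine if all degrees in the orthant are at
    least \<open>C\<close>.\<close>
  have along: "rational_on Z (partial_series I a)"
    if i: "i \<in> I" and "0 \<le> d i" and C: "d i = 0 \<or> (\<forall>n\<in>orthant I a. C \<le> deg n)" for i a
  proof -
    define u where "u = (\<lambda>_. 0)(i := N)"
    have deg_u: "deg u = int N * d i"
      unfolding u_def by (rule deg_unit)
    have dvd: "N dvd u j" for j by (simp add: u_def)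
    show ?thesis
    proof (rule partial_series_recurrence[where u = u])
      show "u j = 0" if "j \<notin> I" for j using that i by (auto simp: u_def)
      show "rational_on Z (\<lambda>z. partial_series I a z - partial_series I (\<lambda>j. a j + u j) z)" for a
      proof -
        have "a(i := a i + N) = (\<lambda>j. a j + u j)" by (auto simp: u_def)
        then show ?thesis using peel[OF i, of a N] by (simp only:)
      qed
      show "monomial_at z u \<noteq> 1" if "z \<in> Z" for z
      proof (rule monomial_neq_1_nonneg[OF that _ _ dvd])
        have "u i \<noteq> 0" using N_pos by (simp add: u_def)
        then show "u \<noteq> (\<lambda>_. 0)" by auto
      qed (use \<open>0 \<le> d i\<close> deg_u in simp)
      show "\<phi> (\<lambda>j. n j + u j + u j) = 2 * \<phi> (\<lambda>j. n j + u j) - \<phi> n"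
        if n: "n \<in> orthant I a" for n
      proof (cases "d i = 0")
        case True
        then have "deg u = 0" using deg_u by simp
        from periodic_deg[OF this dvd] show ?thesis by simp
      next
        case False
        with C n have "C \<le> deg n" by blast
        moreover have "0 \<le> deg u" using \<open>0 \<le> d i\<close> by (simp add: deg_u)
        moreover from calculation have "C \<le> deg (\<lambda>j. n j + u j)" by (simp add: deg_add)
        ultimately show ?thesis by (simp add: linear_deg[OF _ _ dvd])
      qed
    qed
  qed
  consider "I = {}" | i where "i \<in> I" "d i = 0"
    | i j where "i \<in> I" "j \<in> I" "d i > 0" "d j < 0"
    | i where "i \<in> I" "\<forall>i\<in>I. d i > 0" | i where "i \<in> I" "\<forall>i\<in>I. d i < 0"
  proof -
    have "I = {} \<or> (\<exists>i\<in>I. d i = 0) \<or> (\<exists>i\<in>I. \<exists>j\<in>I. d i > 0 \<and> d j < 0) \<or>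
        (\<exists>i\<in>I. \<forall>j\<in>I. d j > 0) \<or> (\<exists>i\<in>I. \<forall>j\<in>I. d j < 0)"
    proof (cases "\<exists>i\<in>I. d i > 0")
      case True
      then show ?thesis by (metis linorder_less_linear)
    next
      case False
      then have "\<forall>i\<in>I. d i = 0 \<or> d i < 0" by force
      then show ?thesis by blast
    qed
    then show ?thesis using that by blast
  qed
  then show ?case
  proof cases
    case 1
    then have "partial_series I a = (\<lambda>z. of_int (\<phi> a) * monomial_at z a)"
      by (simp add: fun_eq_iff partial_series_def orthant_empty summand_def)
    then show ?thesis using rational_on_monomial[of Z "\<phi> a" a] by simp
  next
    case 2
    then show ?thesis using along by simp
  next
    case (3 i j)
    \<comment> \<open>Multiples of \<open>N\<close> chosen so that
      \<open>x * d i + y * d j = 0\<close>.\<close>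
    define x y where "x = N * nat (- d j)" and "y = N * nat (d i)"
    define u where "u = (\<lambda>k. ((\<lambda>_. 0)(i := x)) k + ((\<lambda>_. 0)(j := y)) k)"
    have ij: "i \<noteq> j" using 3 by auto
    have xy: "x > 0" "y > 0" using 3 N_pos by (auto simp: x_def y_def)
    have deg_u: "deg u = 0"
      unfolding u_def deg_add deg_unit using 3 by (simp add: x_def y_def)
    have dvd: "N dvd u k" for k by (auto simp: u_def x_def y_def)
    show ?thesis
    proof (rule partial_series_recurrence[where u = u])
      show "u k = 0" if "k \<notin> I" for k using that 3 by (auto simp: u_def)
      show "rational_on Z (\<lambda>z. partial_series I a z - partial_series I (\<lambda>k. a k + u k) z)" for a
      proof -
        \<comment> \<open>The shift by \<open>u\<close> is peeled off in two stages, along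
          \<open>i\<close> and then along \<open>j\<close>.\<close>
        have "(a(i := a i + x))(j := (a(i := a i + x)) j + y) = (\<lambda>k. a k + u k)"
          using ij by (auto simp: u_def)
        then show ?thesis
          using rational_on_add[OF peel[OF 3(1), of a x] peel[OF 3(2), of "a(i := a i + x)" y]]
          by simp
      qed
      show "monomial_at z u \<noteq> 1" if "z \<in> Z" for z
      proof (rule monomial_neq_1_nonneg[OF that])
        have "u i \<noteq> 0" using xy by (simp add: u_def)
        then show "u \<noteq> (\<lambda>_. 0)" by auto
      qed (use deg_u dvd in auto)
      show "\<phi> (\<lambda>k. n k + u k + u k) = 2 * \<phi> (\<lambda>k. n k + u k) - \<phi> n" for n
        using periodic[of u n] periodic[of u "\<lambda>k. n k + u k"] deg_u dvd by (simp add: deg_def)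
    qed
  next
    case (4 i)
    \<comment> \<open>As \<open>d i \<ge> 1\<close>, raising coordinate \<open>i\<close> by
      \<open>m\<close> brings the base point to degree at least \<open>C\<close>; moving further
      into the orthant only increases the degree.\<close>
    define m where "m = nat (C - deg a)"
    define b where "b = (\<lambda>j. a j + ((\<lambda>_. 0)(i := m)) j)"
    have b: "a(i := a i + m) = b" by (auto simp: b_def)
    have "1 \<le> d i" using 4 by force
    then have "int m \<le> int m * d i" by (cases "m = 0") auto
    moreover have "C \<le> deg a + int m" by (simp add: m_def)
    ultimately have degb: "C \<le> deg b" unfolding b_def deg_add deg_unit by linarith
    have "C \<le> deg n" if "n \<in> orthant I b" for n
    proof -
      have "deg b \<le> deg n"
        unfolding deg_def
      proof (rule sum_mono)
        fix j show "int (b j) * d j \<le> int (n j) * d j"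
          using that 4 by (cases "j \<in> I") (auto simp: orthant_def intro!: mult_right_mono less_imp_le)
      qed
      then show ?thesis using degb by simp
    qed
    then have "rational_on Z (partial_series I b)"
      using along[of i b] 4 by (simp add: less_imp_le)
    from rational_on_add[OF peel[OF 4(1), of a m] this] show ?thesis by (simp add: b)
  next
    case (5 i)
    \<comment> \<open>The extra 1 makes the degree at the new base point strictly negative, hence
      also on the whole orthant, where \<open>\<phi>\<close> vanishes.\<close>
    define m where "m = nat (deg a) + 1"
    define b where "b = (\<lambda>j. a j + ((\<lambda>_. 0)(i := m)) j)"
    have b: "a(i := a i + m) = b" by (auto simp: b_def)
    have "d i \<le> -1" using 5 by force
    then have "int m * d i \<le> int m * (- 1)" by (intro mult_left_mono) auto
    moreover have "deg a < int m" by (simp add: m_def)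
    ultimately have degb: "deg b < 0" unfolding b_def deg_add deg_unit by linarith
    have "summand z n = 0" if "n \<in> orthant I b" for n z
    proof -
      have "deg n \<le> deg b"
        unfolding deg_def
      proof (rule sum_mono)
        fix j show "int (n j) * d j \<le> int (b j) * d j"
          using that 5 by (cases "j \<in> I") (auto simp: orthant_def intro!: mult_right_mono_neg less_imp_le)
      qed
      then show ?thesis using degb negative[of n] by (simp add: deg_def summand_def)
    qed
    then have "partial_series I b z = 0" for z
      by (simp add: partial_series_def infsum_0)
    then show ?thesis using peel[OF 5(1), of a m] by (simp add: b)
  qed
qed

end

section \<open>Divisors on a multigraph\<close>

lemma divisors_iff: "X \<in> divisors G \<longleftrightarrow> Poly_Mapping.keys X \<subseteq> verts G"
  by (simp add: divisors_def)

lemma zero_divisors: "0 \<in> divisors G"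
  by (simp add: divisors_iff)

lemma single_divisors: "u \<in> verts G \<Longrightarrow> Poly_Mapping.single u c \<in> divisors G"
  by (simp add: divisors_iff)

lemma add_divisors: "X \<in> divisors G \<Longrightarrow> Y \<in> divisors G \<Longrightarrow> X + Y \<in> divisors G"
  unfolding divisors_iff using keys_add[of X Y] by blast

lemma diff_divisors: "X \<in> divisors G \<Longrightarrow> Y \<in> divisors G \<Longrightarrow> X - Y \<in> divisors G"
  unfolding divisors_iff using keys_diff[of X Y] by blast

lemma frag_cmul_divisors: "X \<in> divisors G \<Longrightarrow> frag_cmul c X \<in> divisors G"
  unfolding divisors_iff using keys_cmul[of c X] by blast

lemma sum_divisors: "(\<And>i. i \<in> I \<Longrightarrow> X i \<in> divisors G) \<Longrightarrow> sum X I \<in> divisors G"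
  by (induction I rule: infinite_finite_induct) (simp_all add: zero_divisors add_divisors)

lemma lookup_divisors: "X \<in> divisors G \<Longrightarrow> u \<notin> verts G \<Longrightarrow> Poly_Mapping.lookup X u = 0"
  unfolding divisors_iff by (auto simp: in_keys_iff)

lemmas divisors_intros =
  zero_divisors single_divisors add_divisors diff_divisors frag_cmul_divisors sum_divisors

text \<open>The range lies in a finite interval, and once the maximum is reached monotonicity keeps
  it.\<close>

lemma bounded_mono_eventually_const:
  fixes f :: "nat \<Rightarrow> int"
  assumes "mono f" "\<And>t. f t \<le> B"
  shows "\<exists>T c. \<forall>t\<ge>T. f t = c"
proof -
  have "range f \<subseteq> {f 0..B}"
    using assms by (auto simp: mono_def)
  then have fin: "finite (range f)"
    using finite_subset by blast
  then have "Max (range f) \<in> range f" by (intro Max_in) auto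
  then obtain T where T: "f T = Max (range f)" by (metis imageE)
  have "f t = f T" if "t \<ge> T" for t
    using monoD[OF assms(1) that] Max_ge[OF fin, of "f t"] T by simp
  then show ?thesis by blast
qed

context finite_connected_multigraph
begin

abbreviation lk :: "('v \<Rightarrow>\<^sub>0 int) \<Rightarrow> 'v \<Rightarrow> int" where
  "lk \<equiv> Poly_Mapping.lookup"

lemma divisor_degree_eq:
  assumes "X \<in> divisors G"
  shows "divisor_degree X = (\<Sum>u\<in>verts G. lk X u)"
  unfolding divisor_degree_def
  using assms by (intro sum.mono_neutral_left) (auto simp: divisors_iff in_keys_iff)

lemma divisor_degree_zero: "divisor_degree 0 = 0"
  by (simp add: divisor_degree_def)

lemma divisor_degree_single: "divisor_degree (Poly_Mapping.single u c) = c"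
  by (simp add: divisor_degree_def)

lemma divisor_degree_add:
  "X \<in> divisors G \<Longrightarrow> Y \<in> divisors G \<Longrightarrow>
    divisor_degree (X + Y) = divisor_degree X + divisor_degree Y"
  by (simp add: divisor_degree_eq add_divisors lookup_add sum.distrib)

lemma divisor_degree_diff:
  "X \<in> divisors G \<Longrightarrow> Y \<in> divisors G \<Longrightarrow>
    divisor_degree (X - Y) = divisor_degree X - divisor_degree Y"
  by (simp add: divisor_degree_eq diff_divisors lookup_minus sum_subtractf)

lemma divisor_degree_frag_cmul:
  "X \<in> divisors G \<Longrightarrow> divisor_degree (frag_cmul c X) = c * divisor_degree X"
  by (simp add: divisor_degree_eq frag_cmul_divisors sum_distrib_left)

lemma divisor_degree_sum:
  assumes "\<And>i. i \<in> I \<Longrightarrow> X i \<in> divisors G"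
  shows "divisor_degree (\<Sum>i\<in>I. X i) = (\<Sum>i\<in>I. divisor_degree (X i))"
  using assms
  by (induction I rule: infinite_finite_induct)
    (simp_all add: divisor_degree_zero divisor_degree_add sum_divisors)

lemma effective_degree_nonneg: "effective X \<Longrightarrow> 0 \<le> divisor_degree X"
  by (auto simp: effective_def divisor_degree_def intro: sum_nonneg)

lemma lookup_principal_divisor:
  "lk (principal_divisor G f) u =
    (if u \<in> verts G then \<Sum>e\<in>out_arcs G u. f u - f (head G e) else 0)"
  by (simp add: principal_divisor_def lookup_sum lookup_single when_def)

lemma principal_divisor_divisors: "principal_divisor G f \<in> divisors G"
  unfolding divisors_iff by (auto simp: in_keys_iff lookup_principal_divisor split: if_splits)

lemma principal_divisor_add:
  "principal_divisor G (\<lambda>u. f u + g u) = principal_divisor G f + principal_divisor G g"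
  by (rule poly_mapping_eqI)
    (simp add: lookup_principal_divisor lookup_add sum.distrib sum_subtractf distrib_left)

lemma principal_divisor_mult:
  "principal_divisor G (\<lambda>u. c * f u) = frag_cmul c (principal_divisor G f)"
  by (rule poly_mapping_eqI)
    (simp add: lookup_principal_divisor sum_distrib_left right_diff_distrib)

lemma principal_divisor_diff:
  "principal_divisor G (\<lambda>u. f u - g u) = principal_divisor G f - principal_divisor G g"
  by (rule poly_mapping_eqI)
    (simp add: lookup_principal_divisor lookup_minus sum_subtractf right_diff_distrib)

section \<open>The Laplacian as a quadratic form\<close>

definition pairing :: "('v \<Rightarrow> int) \<Rightarrow> ('v \<Rightarrow> int) \<Rightarrow> int" where
  "pairing g h = (\<Sum>u\<in>verts G. g u * h u)"

lemma sum_arcs_reverse: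
  fixes F :: "'v \<Rightarrow> 'v \<Rightarrow> int"
  shows "(\<Sum>e\<in>arcs G. F (tail G e) (head G e)) = (\<Sum>e\<in>arcs G. F (head G e) (tail G e))"
  by (subst sum.permute[OF arev_permutes_arcs]) (auto intro: sum.cong)

text \<open>The Dirichlet form of the graph: arcs are grouped by tail and the sum is added to its
  reversal. The factor 2 appears because every edge is a pair of arcs.\<close>

lemma pairing_principal_divisor:
  "2 * pairing g (lk (principal_divisor G f)) =
    (\<Sum>e\<in>arcs G. (g (tail G e) - g (head G e)) * (f (tail G e) - f (head G e)))"
proof -
  have "pairing g (lk (principal_divisor G f)) =
      (\<Sum>u\<in>verts G. \<Sum>e\<in>out_arcs G u. g (tail G e) * (f (tail G e) - f (head G e)))"
    unfolding pairing_def
    by (intro sum.cong) (auto simp: lookup_principal_divisor sum_distrib_left intro!: sum.cong)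
  also have "\<dots> = (\<Sum>e\<in>arcs G. g (tail G e) * (f (tail G e) - f (head G e)))"
    unfolding out_arcs_def by (rule sum.group) auto
  finally have 1: "pairing g (lk (principal_divisor G f)) = \<dots>" .
  have 2: "\<dots> = (\<Sum>e\<in>arcs G. g (head G e) * (f (head G e) - f (tail G e)))"
    by (rule sum_arcs_reverse)
  have "2 * pairing g (lk (principal_divisor G f)) =
      (\<Sum>e\<in>arcs G. g (tail G e) * (f (tail G e) - f (head G e))) +
      (\<Sum>e\<in>arcs G. g (head G e) * (f (head G e) - f (tail G e)))"
    using 1 2 by simp
  also have "\<dots> = (\<Sum>e\<in>arcs G. (g (tail G e) - g (head G e)) * (f (tail G e) - f (head G e)))"
    unfolding sum.distrib[symmetric] by (intro sum.cong refl) (simp add: algebra_simps)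
  finally show ?thesis .
qed

lemma pairing_principal_divisor_commute:
  "pairing g (lk (principal_divisor G f)) = pairing f (lk (principal_divisor G g))"
  using pairing_principal_divisor[of g f] pairing_principal_divisor[of f g]
  by (simp add: mult.commute)

text \<open>The degree is the pairing with the constant 1, whose differences along arcs
  vanish.\<close>

lemma divisor_degree_principal_divisor: "divisor_degree (principal_divisor G f) = 0"
proof -
  have "divisor_degree (principal_divisor G f) = pairing (\<lambda>_. 1) (lk (principal_divisor G f))"
    by (simp add: pairing_def divisor_degree_eq principal_divisor_divisors)
  then show ?thesis using pairing_principal_divisor[of "\<lambda>_. 1" f] by simp
qed

text \<open>Pairing \<open>f\<close> with its Laplacian gives a sum of squares over the arcs, so
  \<open>f\<close> agrees at the ends of every arc, and connectedness does the rest.\<close>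

lemma principal_divisor_kernel:
  assumes "principal_divisor G f = 0" "u \<in> verts G" "v \<in> verts G"
  shows "f u = f v"
proof -
  have "(\<Sum>e\<in>arcs G. (f (tail G e) - f (head G e)) * (f (tail G e) - f (head G e))) = 0"
    using pairing_principal_divisor[of f f] assms(1) by (simp add: pairing_def)
  then have arc: "f (tail G e) = f (head G e)" if "e \<in> arcs G" for e
    using that by (subst (asm) sum_nonneg_eq_0_iff) auto
  have "(u, v) \<in> rtrancl_on (verts G) ((arcs_ends G)\<^sup>s)"
    using connected_G assms(2,3) by (simp add: connected_conv)
  then show ?thesis
  proof induction
    case (step y z)
    then have "f y = f z"
      using arc by (auto simp: symcl_def arcs_ends_def arc_to_ends_def)
    with step show ?case by simp
  qed simp
qed

section \<open>Finiteness of the Jacobian\<close>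

lemma finite_bounded_divisors:
  "finite {X \<in> divisors G. \<forall>u\<in>verts G. lo u \<le> lk X u \<and> lk X u \<le> hi u}" (is "finite ?S")
proof -
  let ?r = "\<lambda>X. restrict (lk X) (verts G)"
  have "?r ` ?S \<subseteq> (\<Pi>\<^sub>E u\<in>verts G. {lo u..hi u})" by auto
  moreover have "finite (\<Pi>\<^sub>E u\<in>verts G. {lo u..hi u})" by (intro finite_PiE) auto
  moreover have "inj_on ?r ?S"
  proof (rule inj_onI)
    fix X Y assume *: "X \<in> ?S" "Y \<in> ?S" "?r X = ?r Y"
    show "X = Y"
    proof (rule poly_mapping_eqI)
      fix u show "lk X u = lk Y u"
      proof (cases "u \<in> verts G")
        case True
        then show ?thesis using fun_cong[OF *(3), of u] by simp
      qed (use * lookup_divisors[of X G u] lookup_divisors[of Y G u] in simp)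
    qed
  qed
  ultimately show ?thesis by (blast intro: finite_imageD finite_subset[of "?r ` ?S"])
qed

text \<open>
  A representative of least Euclidean norm in its class cannot be shortened by firing a single
  vertex in either direction, which bounds its Laplacian.
\<close>

lemma bounded_laplacian:
  "\<exists>B. \<forall>X\<in>divisors G. \<exists>f. \<forall>v\<in>verts G.
    \<bar>lk (principal_divisor G (lk (X - principal_divisor G f))) v\<bar> \<le> B v"
proof -
  \<comment> \<open>\<open>d v\<close> is the effect of firing \<open>v\<close>, and
    \<open>B v\<close> is its squared norm.\<close>
  define d where "d v = principal_divisor G (\<lambda>u. if u = v then 1 else 0)" for v
  define B where "B v = pairing (lk (d v)) (lk (d v))" for v
  have "\<exists>f. \<forall>v\<in>verts G.
    \<bar>lk (principal_divisor G (lk (X - principal_divisor G f))) v\<bar> \<le> B v"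
    if X: "X \<in> divisors G" for X
  proof -
    define Q where "Q f = pairing (lk (X - principal_divisor G f)) (lk (X - principal_divisor G f))" for f
    have Q_nonneg: "0 \<le> Q f" for f
      unfolding Q_def pairing_def by (intro sum_nonneg) simp
    obtain f where "\<forall>g. nat (Q f) \<le> nat (Q g)"
      using ex_has_least_nat[of "\<lambda>_. True" undefined "\<lambda>f. nat (Q f)"] by auto
    then have min: "Q f \<le> Q g" for g
      using Q_nonneg[of f] Q_nonneg[of g] by (metis nat_le_eq_zle nle_le)
    define Y where "Y = X - principal_divisor G f"
    have "\<bar>lk (principal_divisor G (lk Y)) v\<bar> \<le> B v" if v: "v \<in> verts G" for v
    proof -
      \<comment> \<open>Compares the minimal norm with that after firing \<open>v\<close> once in
        the direction \<open>s = 1\<close> or \<open>s = -1\<close>.\<close>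
      have step: "0 \<le> B v - 2 * s * pairing (lk Y) (lk (d v))" if "s * s = 1" for s
      proof -
        have "X - principal_divisor G (\<lambda>u. f u + s * (if u = v then 1 else 0)) = Y - frag_cmul s (d v)"
          by (simp add: principal_divisor_add principal_divisor_mult Y_def d_def)
        then have "Q f \<le> pairing (lk (Y - frag_cmul s (d v))) (lk (Y - frag_cmul s (d v)))"
          using min[of "\<lambda>u. f u + s * (if u = v then 1 else 0)"] by (simp only: Q_def)
        also have "\<dots> = (\<Sum>u\<in>verts G. lk Y u * lk Y u - 2 * s * (lk Y u * lk (d v) u) +
            (s * s) * (lk (d v) u * lk (d v) u))"
          unfolding pairing_def by (intro sum.cong) (auto simp: lookup_minus algebra_simps)
        also have "\<dots> = Q f - 2 * s * pairing (lk Y) (lk (d v)) + B v"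
          by (simp add: that sum.distrib sum_subtractf Q_def pairing_def B_def flip: Y_def sum_distrib_left)
        finally show ?thesis by simp
      qed
      \<comment> \<open>Self-adjointness turns this pairing into the Laplacian of \<open>Y\<close>
        at \<open>v\<close>.\<close>
      have "pairing (lk Y) (lk (d v)) =
          pairing (\<lambda>u. if u = v then 1 else 0) (lk (principal_divisor G (lk Y)))"
        unfolding d_def by (rule pairing_principal_divisor_commute)
      also have "\<dots> = (\<Sum>u\<in>verts G. if u = v then lk (principal_divisor G (lk Y)) u else 0)"
        unfolding pairing_def by (intro sum.cong) auto
      also have "\<dots> = lk (principal_divisor G (lk Y)) v"
        using v by simp
      finally show ?thesis using step[of 1] step[of "-1"] by simp
    qed
    then show ?thesis unfolding Y_def by blast
  qed
  then show ?thesis by blast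
qed

section \<open>Principal divisors and the exponent of the Jacobian\<close>

definition principal :: "('v \<Rightarrow>\<^sub>0 int) \<Rightarrow> bool" where
  "principal X \<longleftrightarrow> (\<exists>f. X = principal_divisor G f)"

lemma principal_add: "principal X \<Longrightarrow> principal Y \<Longrightarrow> principal (X + Y)"
  unfolding principal_def by (metis principal_divisor_add)

lemma principal_diff: "principal X \<Longrightarrow> principal Y \<Longrightarrow> principal (X - Y)"
  unfolding principal_def by (metis principal_divisor_diff)

lemma principal_frag_cmul: "principal X \<Longrightarrow> principal (frag_cmul c X)"
  unfolding principal_def by (metis principal_divisor_mult)

lemma principal_zero: "principal 0"
  unfolding principal_def by (metis principal_divisor_mult frag_cmul_zero)

lemma principal_sum: "(\<And>i. i \<in> I \<Longrightarrow> principal (X i)) \<Longrightarrow> principal (sum X I)"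
  by (induction I rule: infinite_finite_induct) (auto simp: principal_zero principal_add)

text \<open>Pigeonhole on the multiples of \<open>X\<close>: reduced representatives have only
  finitely many Laplacians.\<close>

lemma principal_multiple:
  assumes X: "X \<in> divisors G" "divisor_degree X = 0"
  shows "\<exists>n>0. principal (frag_cmul (int n) X)"
proof -
  obtain B where B: "\<forall>X\<in>divisors G. \<exists>f. \<forall>v\<in>verts G.
      \<bar>lk (principal_divisor G (lk (X - principal_divisor G f))) v\<bar> \<le> B v"
    using bounded_laplacian by blast
  have "\<forall>j. \<exists>f. \<forall>v\<in>verts G.
      \<bar>lk (principal_divisor G (lk (frag_cmul (int j) X - principal_divisor G f))) v\<bar> \<le> B v"
    using B X(1) frag_cmul_divisors by blast
  then obtain f where f: "\<And>j v. v \<in> verts G \<Longrightarrow>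
      \<bar>lk (principal_divisor G (lk (frag_cmul (int j) X - principal_divisor G (f j)))) v\<bar> \<le> B v"
    by metis
  define Y where "Y j = frag_cmul (int j) X - principal_divisor G (f j)" for j
  \<comment> \<open>The coefficients of \<open>Y j\<close> are read as a function on the vertices,
    to which the Laplacian is applied.\<close>
  define L where "L j = principal_divisor G (lk (Y j))" for j
  have bounds: "- B v \<le> lk (L j) v \<and> lk (L j) v \<le> B v" if "v \<in> verts G" for j v
    using f[OF that, of j] unfolding L_def Y_def by linarith
  have "range L \<subseteq> {X \<in> divisors G. \<forall>u\<in>verts G. - B u \<le> lk X u \<and> lk X u \<le> B u}"
    using bounds by (auto simp: L_def principal_divisor_divisors)
  then have "finite (range L)"
    by (rule finite_subset) (rule finite_bounded_divisors)
  \<comment> \<open>Two multiples of \<open>X\<close> have short representatives with the same Laplacian; these differ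
    by a constant of degree 0, hence coincide.\<close>
  then have "\<not> inj L" using finite_imageD[of L UNIV] by auto
  then obtain i j where ij: "i < j" "L i = L j"
    unfolding inj_def by (metis linorder_neqE_nat)
  have Y_div: "Y j \<in> divisors G" for j
    unfolding Y_def by (intro divisors_intros principal_divisor_divisors X)
  have Y_deg: "divisor_degree (Y j) = 0" for j
    unfolding Y_def
    by (simp add: divisor_degree_diff divisor_degree_frag_cmul divisor_degree_principal_divisor
        frag_cmul_divisors principal_divisor_divisors X)
  define W where "W = Y j - Y i"
  have W: "W \<in> divisors G" "divisor_degree W = 0"
    by (simp_all add: W_def diff_divisors Y_div divisor_degree_diff Y_deg)
  have "principal_divisor G (lk W) = 0"
  proof -
    have "lk W = (\<lambda>u. lk (Y j) u - lk (Y i) u)"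
      by (simp add: W_def lookup_minus fun_eq_iff)
    then show ?thesis using ij(2) by (simp add: principal_divisor_diff L_def)
  qed
  note const = principal_divisor_kernel[OF this]
  have "W = 0"
  proof (rule poly_mapping_eqI)
    fix u show "lk W u = lk 0 u"
    proof (cases "u \<in> verts G")
      case True
      have "(\<Sum>v\<in>verts G. lk W v) = (\<Sum>v\<in>verts G. lk W u)"
        by (intro sum.cong refl const True)
      then have "int (card (verts G)) * lk W u = 0"
        using W by (simp add: divisor_degree_eq)
      moreover have "card (verts G) \<noteq> 0" using True by auto
      ultimately show ?thesis by simp
    qed (simp add: lookup_divisors[OF W(1)])
  qed
  then have eq: "frag_cmul (int j) X - frag_cmul (int i) X = principal_divisor G (f j) - principal_divisor G (f i)"
    by (simp add: W_def Y_def algebra_simps)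
  have "frag_cmul (int (j - i)) X = frag_cmul (int j) X - frag_cmul (int i) X"
    using ij(1) by (intro poly_mapping_eqI) (simp add: lookup_minus of_nat_diff left_diff_distrib)
  also have "\<dots> = principal_divisor G (\<lambda>u. f j u - f i u)"
    by (simp add: eq principal_divisor_diff)
  finally show ?thesis using ij(1) unfolding principal_def by (intro exI[of _ "j - i"]) auto
qed

text \<open>Divisors of degree 0 are generated by the differences \<open>v - q\<close>, so the
  product of annihilating multiples of these annihilates every class.\<close>

lemma jacobian_exponent:
  "\<exists>N>0. \<forall>X\<in>divisors G. divisor_degree X = 0 \<longrightarrow> principal (frag_cmul (int N) X)"
proof -
  obtain q where q: "q \<in> verts G" using connected_G by (auto simp: connected_conv)
  have "\<forall>v\<in>verts G. \<exists>n>0. principal (frag_cmul (int n) (frag_of v - frag_of q))"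
    using q by (intro ballI principal_multiple)
      (simp_all add: divisors_intros divisor_degree_diff divisor_degree_single)
  then obtain n where n: "\<forall>v\<in>verts G. n v > 0 \<and> principal (frag_cmul (int (n v)) (frag_of v - frag_of q))"
    by metis
  define N where "N = (\<Prod>v\<in>verts G. n v)"
  have "N > 0" using n by (simp add: N_def prod_pos)
  moreover have "principal (frag_cmul (int N) X)"
    if X: "X \<in> divisors G" "divisor_degree X = 0" for X
  proof -
    have "principal (frag_cmul (int N) (frag_of v - frag_of q))" if v: "v \<in> verts G" for v
    proof -
      have "n v dvd N" unfolding N_def using v by (intro dvd_prodI) auto
      then obtain k where "N = k * n v" by (metis dvd_def mult.commute)
      then have "frag_cmul (int N) (frag_of v - frag_of q) =
          frag_cmul (int k) (frag_cmul (int (n v)) (frag_of v - frag_of q))"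
        by (simp only: frag_cmul_cmul of_nat_mult)
      then show ?thesis using n v principal_frag_cmul by metis
    qed
    then have "principal (\<Sum>v\<in>verts G. frag_cmul (lk X v) (frag_cmul (int N) (frag_of v - frag_of q)))"
      by (intro principal_sum) (rule principal_frag_cmul)
    moreover have "frag_cmul (int N) X =
        (\<Sum>v\<in>verts G. frag_cmul (lk X v) (frag_cmul (int N) (frag_of v - frag_of q)))"
    proof (rule poly_mapping_eqI)
      fix u
      \<comment> \<open>The terms at \<open>q\<close> add up to \<open>-N\<close> times the degree
        of \<open>X\<close>, which is 0.\<close>
      have "(\<Sum>v\<in>verts G. lk X v * (int N * ((if u = v then 1 else 0) - (if u = q then 1 else 0)))) =
          (\<Sum>v\<in>verts G. (if v = u then int N * lk X v else 0) - (if u = q then int N else 0) * lk X v)"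
        by (intro sum.cong) auto
      also have "\<dots> = int N * lk X u"
        using X by (simp add: sum_subtractf divisor_degree_eq lookup_divisors flip: sum_distrib_left)
      finally show "lk (frag_cmul (int N) X) u =
          lk (\<Sum>v\<in>verts G. frag_cmul (lk X v) (frag_cmul (int N) (frag_of v - frag_of q))) u"
        by (simp only: lookup_sum lookup_minus lookup_frag_cmul lookup_frag_of)
    qed
    ultimately show ?thesis by simp
  qed
  ultimately show ?thesis by blast
qed

section \<open>Elementary properties of the rank\<close>

text \<open>Positivity refers to an effective representative, not to the degree.\<close>

definition positive_class :: "('v \<Rightarrow>\<^sub>0 int) \<Rightarrow> bool" where
  "positive_class X \<longleftrightarrow> linear_system G X \<noteq> {}"

lemma linear_system_cong: "principal (X - Y) \<Longrightarrow> linear_system G X = linear_system G Y"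
proof -
  have "linear_system G X \<subseteq> linear_system G Y" if "principal (X - Y)" for X Y
  proof
    fix Z assume "Z \<in> linear_system G X"
    then have Z: "Z \<in> divisors G" "effective Z" "principal (Z - X)"
      by (auto simp: linear_system_def linearly_equivalent_def principal_def)
    have "principal (Z - Y)" using principal_add[OF Z(3) that] by simp
    with Z show "Z \<in> linear_system G Y"
      by (auto simp: linear_system_def linearly_equivalent_def principal_def)
  qed
  moreover assume "principal (X - Y)"
  moreover from principal_diff[OF principal_zero this] have "principal (Y - X)" by simp
  ultimately show ?thesis by blast
qed

lemma divisor_rank_cong:
  assumes "principal (X - Y)"
  shows "divisor_rank G X = divisor_rank G Y"
proof -
  have "linear_system G (X - E) = linear_system G (Y - E)" for E
    using assms by (intro linear_system_cong) simp
  then show ?thesis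
    using linear_system_cong[OF assms] by (simp add: divisor_rank_def)
qed

lemma positive_class_effective: "X \<in> divisors G \<Longrightarrow> effective X \<Longrightarrow> positive_class X"
  using principal_zero
  by (force simp: positive_class_def linear_system_def linearly_equivalent_def principal_def)

lemma positive_class_add:
  assumes "positive_class X" "E \<in> divisors G" "effective E"
  shows "positive_class (X + E)"
proof -
  obtain Z f where "Z \<in> divisors G" "effective Z" "Z - X = principal_divisor G f"
    using assms(1) by (auto simp: positive_class_def linear_system_def linearly_equivalent_def)
  with assms have "Z + E \<in> linear_system G (X + E)"
    by (auto simp: linear_system_def linearly_equivalent_def add_divisors effective_def lookup_add)
  then show ?thesis by (auto simp: positive_class_def)
qed

lemma positive_class_degree:
  assumes "positive_class X" "X \<in> divisors G"
  shows "0 \<le> divisor_degree X"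
proof -
  obtain Z f where Z: "Z \<in> divisors G" "effective Z" "Z - X = principal_divisor G f"
    using assms(1) by (auto simp: positive_class_def linear_system_def linearly_equivalent_def)
  then have "divisor_degree Z - divisor_degree X = 0"
    using divisor_degree_principal_divisor[of f] assms by (metis divisor_degree_diff)
  with effective_degree_nonneg[OF Z(2)] show ?thesis by simp
qed

section \<open>Characterisation of the rank by admissible values\<close>

text \<open>The condition maximised in the rank. It holds vacuously for negative \<open>r\<close>,
  hence the restrictions to \<open>0 \<le> r\<close> below.\<close>

definition admissible :: "('v \<Rightarrow>\<^sub>0 int) \<Rightarrow> int \<Rightarrow> bool" where
  "admissible X r \<longleftrightarrow> (\<forall>E\<in>divisors G. effective E \<and> divisor_degree E = r \<longrightarrow> positive_class (X - E))"

lemma effective_single: "0 \<le> c \<Longrightarrow> effective (Poly_Mapping.single u c)"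
  by (simp add: effective_def lookup_single when_def)

lemma effective_add: "effective X \<Longrightarrow> effective Y \<Longrightarrow> effective (X + Y)"
  by (simp add: effective_def lookup_add)

lemma admissible_zero: "admissible X 0 \<longleftrightarrow> positive_class X"
proof -
  have "E = 0" if "E \<in> divisors G" "effective E" "divisor_degree E = 0" for E
  proof (rule poly_mapping_eqI)
    fix u show "lk E u = lk 0 u"
    proof (cases "u \<in> verts G")
      case True
      have "\<forall>v\<in>verts G. lk E v = 0"
        using that by (subst sum_nonneg_eq_0_iff[symmetric]) (auto simp: divisor_degree_eq effective_def)
      then show ?thesis using True by simp
    qed (use that in \<open>simp add: lookup_divisors\<close>)
  qed
  then have "E \<in> divisors G \<and> effective E \<and> divisor_degree E = 0 \<longleftrightarrow> E = 0" for E
    by (auto simp: zero_divisors effective_def divisor_degree_zero)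
  then show ?thesis unfolding admissible_def by (metis diff_zero)
qed

text \<open>Pad \<open>E\<close> with \<open>s - r\<close> copies of a vertex and add them back
  afterwards.\<close>

lemma admissible_antimono:
  assumes "admissible X s" "0 \<le> r" "r \<le> s"
  shows "admissible X r"
  unfolding admissible_def
proof (intro ballI impI)
  fix E assume E: "E \<in> divisors G" "effective E \<and> divisor_degree E = r"
  obtain q where q: "q \<in> verts G" using connected_G by (auto simp: connected_conv)
  define S where "S = Poly_Mapping.single q (s - r)"
  have S: "S \<in> divisors G" "effective S" "divisor_degree S = s - r"
    using q assms by (simp_all add: S_def single_divisors effective_single divisor_degree_single)
  have "positive_class (X - (E + S))"
    using assms(1) E S by (simp add: admissible_def add_divisors effective_add divisor_degree_add)
  from positive_class_add[OF this S(1,2)] show "positive_class (X - E)"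
    by (simp add: algebra_simps)
qed

lemma admissible_le_degree:
  assumes "admissible X r" "0 \<le> r" "X \<in> divisors G"
  shows "r \<le> divisor_degree X"
proof -
  obtain q where q: "q \<in> verts G" using connected_G by (auto simp: connected_conv)
  define S where "S = Poly_Mapping.single q r"
  have S: "S \<in> divisors G" "effective S" "divisor_degree S = r"
    using q assms by (simp_all add: S_def single_divisors effective_single divisor_degree_single)
  have "positive_class (X - S)"
    using assms(1) S by (simp add: admissible_def)
  from positive_class_degree[OF this] S assms show ?thesis
    by (simp add: diff_divisors divisor_degree_diff)
qed

text \<open>The admissible values are bounded by the degree and, among nonnegative integers, closed
  downwards, so \<open>GREATEST\<close> is attained and comparison with it is admissibility.\<close>

lemma
  assumes X: "X \<in> divisors G"
  shows divisor_rank_ge: "- 1 \<le> divisor_rank G X"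
    and le_divisor_rank_iff: "0 \<le> r \<Longrightarrow> r \<le> divisor_rank G X \<longleftrightarrow> admissible X r"
proof -
  have "- 1 \<le> divisor_rank G X \<and> (\<forall>r\<ge>0. r \<le> divisor_rank G X \<longleftrightarrow> admissible X r)"
  proof (cases "positive_class X")
    case False
    then have "divisor_rank G X = - 1" by (simp add: divisor_rank_def positive_class_def)
    moreover have "\<not> admissible X r" if "0 \<le> r" for r
      using False admissible_antimono[of X r 0] that admissible_zero by blast
    ultimately show ?thesis by auto
  next
    case True
    define m where "m = Max {r \<in> {0..divisor_degree X}. admissible X r}"
    have fin: "finite {r \<in> {0..divisor_degree X}. admissible X r}"
      by (rule finite_subset[of _ "{0..divisor_degree X}"]) auto
    have "0 \<in> {r \<in> {0..divisor_degree X}. admissible X r}"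
      using True admissible_zero positive_class_degree[OF True X] by simp
    then have m: "0 \<le> m" "admissible X m"
      using Max_in[OF fin] unfolding m_def by force+
    \<comment> \<open>Negative \<open>r\<close> has to be covered too, since \<open>GREATEST\<close>
      ranges over all integers.\<close>
    have le: "r \<le> m" if "admissible X r" for r
    proof (cases "0 \<le> r")
      case True
      with that admissible_le_degree[OF that True X] show ?thesis
        unfolding m_def by (intro Max_ge fin) simp
    qed (use m in simp)
    have "divisor_rank G X = (GREATEST r. admissible X r)"
      using True by (simp add: divisor_rank_def admissible_def positive_class_def)
    also have "\<dots> = m" by (rule Greatest_equality) (use m le in auto)
    finally have "divisor_rank G X = m" .
    moreover have "r \<le> m \<longleftrightarrow> admissible X r" if "0 \<le> r" for r
      using le admissible_antimono[OF m(2) that] by blast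
    moreover have "- 1 \<le> m" using m(1) by simp
    ultimately show ?thesis by blast
  qed
  then show "- 1 \<le> divisor_rank G X" "0 \<le> r \<Longrightarrow> r \<le> divisor_rank G X \<longleftrightarrow> admissible X r"
    by auto
qed

lemma divisor_rank_negative:
  assumes "X \<in> divisors G" "divisor_degree X < 0"
  shows "divisor_rank G X = - 1"
  using positive_class_degree[of X] assms by (force simp: divisor_rank_def positive_class_def)

lemma divisor_rank_zero: "0 \<le> divisor_rank G 0"
proof -
  have "admissible 0 0"
    unfolding admissible_zero by (intro positive_class_effective zero_divisors) (simp add: effective_def)
  then show ?thesis using le_divisor_rank_iff[OF zero_divisors] by simp
qed

text \<open>If \<open>E\<close> shows that the rank of \<open>X\<close> is less than
  \<open>m\<close>, then \<open>E + q\<close> shows that the rank of \<open>X + q\<close> is less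
  than \<open>m + 1\<close>.\<close>

lemma divisor_rank_add_frag_of:
  assumes X: "X \<in> divisors G" and q: "q \<in> verts G"
  shows "divisor_rank G (X + frag_of q) \<le> divisor_rank G X + 1"
proof -
  define m where "m = divisor_rank G X + 1"
  have m: "0 \<le> m" "\<not> admissible X m"
    using divisor_rank_ge[OF X] le_divisor_rank_iff[OF X, of m] by (auto simp: m_def)
  then obtain E where E: "E \<in> divisors G" "effective E" "divisor_degree E = m" "\<not> positive_class (X - E)"
    unfolding admissible_def by blast
  have "\<not> admissible (X + frag_of q) (m + 1)"
    unfolding admissible_def
  proof
    assume "\<forall>E\<in>divisors G. effective E \<and> divisor_degree E = m + 1 \<longrightarrow> positive_class (X + frag_of q - E)"
    moreover have "E + frag_of q \<in> divisors G" "effective (E + frag_of q)"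
      "divisor_degree (E + frag_of q) = m + 1"
      using E q by (simp_all add: divisors_intros effective_add effective_single
          divisor_degree_add divisor_degree_single)
    ultimately have "positive_class (X + frag_of q - (E + frag_of q))" by blast
    with E(4) show False by simp
  qed
  moreover have "X + frag_of q \<in> divisors G" using X q by (simp add: divisors_intros)
  ultimately show ?thesis
    using le_divisor_rank_iff[of "X + frag_of q" "m + 1"] m(1) by (simp add: m_def)
qed

section \<open>The rank in large degree\<close>

text \<open>Every class has a representative \<open>b + t q\<close> with \<open>b\<close> in a
  finite box, so the rank need only be studied along finitely many rays.\<close>

lemma divisor_rank_large_degree:
  obtains N :: nat and C :: int where "0 < N"
    and "\<And>X. X \<in> divisors G \<Longrightarrow> C \<le> divisor_degree X \<Longrightarrow> 0 \<le> divisor_rank G X"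
    and "\<And>X Y. X \<in> divisors G \<Longrightarrow> Y \<in> divisors G \<Longrightarrow> divisor_degree Y = 0 \<Longrightarrow>
      divisor_rank G (X + frag_cmul (int N) Y) = divisor_rank G X"
    and "\<And>X Y. X \<in> divisors G \<Longrightarrow> Y \<in> divisors G \<Longrightarrow>
      C \<le> divisor_degree X \<Longrightarrow> 0 \<le> divisor_degree Y \<Longrightarrow>
      divisor_rank G (X + frag_cmul (int N) Y) = divisor_rank G X + int N * divisor_degree Y"
proof -
  obtain q where q: "q \<in> verts G" using connected_G by (auto simp: connected_conv)
  obtain N where N: "0 < N"
    "\<And>X. X \<in> divisors G \<Longrightarrow> divisor_degree X = 0 \<Longrightarrow> principal (frag_cmul (int N) X)"
    using jacobian_exponent by blast
  define C0 where "C0 = int N * int (card (verts G))"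
  define F where "F = {b \<in> divisors G. \<forall>u\<in>verts G. 0 \<le> lk b u \<and> lk b u \<le> int N}"
  have finF: "finite F" unfolding F_def by (rule finite_bounded_divisors)
  have F: "b \<in> divisors G" "effective b" "divisor_degree b \<le> C0" if "b \<in> F" for b
  proof -
    show b: "b \<in> divisors G" using that by (simp add: F_def)
    show "effective b"
      unfolding effective_def
    proof
      fix u show "0 \<le> lk b u"
        using that lookup_divisors[OF b, of u] by (cases "u \<in> verts G") (auto simp: F_def)
    qed
    have "(\<Sum>u\<in>verts G. lk b u) \<le> (\<Sum>u\<in>verts G. int N)"
      using that by (intro sum_mono) (simp add: F_def)
    then show "divisor_degree b \<le> C0" by (simp add: divisor_degree_eq[OF b] C0_def mult.commute)
  qed
  let ?t = "\<lambda>X b. divisor_degree X - divisor_degree b"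
  \<comment> \<open>Divide all coefficients by \<open>N\<close> with remainder \<open>b\<close> and
    quotient \<open>Y\<close>. As \<open>N\<close> annihilates the class of
    \<open>Y - deg(Y) q\<close>, the part \<open>N Y\<close> can be moved to
    \<open>q\<close>.\<close>
  have reduce: "\<exists>b\<in>F. principal (X - (b + Poly_Mapping.single q (?t X b)))"
    if X: "X \<in> divisors G" for X
  proof -
    define b where "b = (\<Sum>v\<in>verts G. Poly_Mapping.single v (lk X v mod int N))"
    define Y where "Y = (\<Sum>v\<in>verts G. Poly_Mapping.single v (lk X v div int N))"
    have lkb: "lk b u = lk X u mod int N" and lkY: "lk Y u = lk X u div int N" for u
      using lookup_divisors[OF X, of u]
      by (simp_all add: b_def Y_def lookup_sum lookup_single when_def)
    have bY: "b \<in> divisors G" "Y \<in> divisors G"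
      unfolding b_def Y_def by (intro sum_divisors single_divisors; assumption)+
    have "b \<in> F"
      using bY(1) N(1) by (auto simp: F_def lkb less_imp_le)
    define W where "W = Y - Poly_Mapping.single q (divisor_degree Y)"
    have W: "W \<in> divisors G" "divisor_degree W = 0"
      using bY q by (simp_all add: W_def diff_divisors single_divisors divisor_degree_diff divisor_degree_single)
    have X_eq: "X = b + frag_cmul (int N) Y"
      by (rule poly_mapping_eqI) (simp add: lookup_add lkb lkY)
    have "?t X b = int N * divisor_degree Y"
      using X_eq bY by (simp add: divisor_degree_add divisor_degree_frag_cmul frag_cmul_divisors)
    then have "X - (b + Poly_Mapping.single q (?t X b)) = frag_cmul (int N) W"
      using X_eq
      by (intro poly_mapping_eqI) (simp add: W_def lookup_add lookup_minus lookup_single when_def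
          right_diff_distrib)
    with N(2)[OF W] \<open>b \<in> F\<close> show ?thesis by (intro bexI[of _ b]) simp_all
  qed
  \<comment> \<open>Elements of \<open>F\<close> have degree at most \<open>C0\<close>, so
    \<open>t\<close> is nonnegative and \<open>b + t q\<close> is itself effective.\<close>
  have pos: "positive_class X" if X: "X \<in> divisors G" "C0 \<le> divisor_degree X" for X
  proof -
    obtain b where b: "b \<in> F" "principal (X - (b + Poly_Mapping.single q (?t X b)))"
      using reduce[OF X(1)] by blast
    have "0 \<le> ?t X b" using F(3)[OF b(1)] X(2) by simp
    then have "positive_class (b + Poly_Mapping.single q (?t X b))"
      using F[OF b(1)] q
      by (intro positive_class_effective divisors_intros effective_add effective_single)
    then show ?thesis using linear_system_cong[OF b(2)] by (simp add: positive_class_def)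
  qed
  \<comment> \<open>A weak form of Riemann's inequality: after removal of \<open>E\<close>, degree
    \<open>C0\<close> remains.\<close>
  have lower: "divisor_degree X - C0 \<le> divisor_rank G X" if X: "X \<in> divisors G" for X
  proof (cases "0 \<le> divisor_degree X - C0")
    case True
    have "admissible X (divisor_degree X - C0)"
      unfolding admissible_def
    proof (intro ballI impI pos)
      fix E assume "E \<in> divisors G" "effective E \<and> divisor_degree E = divisor_degree X - C0"
      then show "X - E \<in> divisors G" "C0 \<le> divisor_degree (X - E)"
        using X by (simp_all add: diff_divisors divisor_degree_diff)
    qed
    then show ?thesis using le_divisor_rank_iff[OF X True] by simp
  qed (use divisor_rank_ge[OF X] in linarith)
  let ?\<rho> = "\<lambda>b t. divisor_rank G (b + Poly_Mapping.single q (int t))"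
  \<comment> \<open>Along \<open>b + t q\<close> the difference of \<open>t\<close> and the rank is monotone and bounded.\<close>
  have "\<forall>b\<in>F. \<exists>T c. \<forall>t\<ge>T. int t - ?\<rho> b t = c"
  proof
    fix b assume b: "b \<in> F"
    have div: "b + Poly_Mapping.single q t \<in> divisors G" for t
      using F(1)[OF b] q by (intro divisors_intros)
    show "\<exists>T c. \<forall>t\<ge>T. int t - ?\<rho> b t = c"
    proof (rule bounded_mono_eventually_const)
      show "mono (\<lambda>t. int t - ?\<rho> b t)"
      proof (rule mono_iff_le_Suc[THEN iffD2], intro allI)
        fix t
        have eq: "b + Poly_Mapping.single q (int (Suc t)) = (b + Poly_Mapping.single q (int t)) + frag_of q"
          by (simp add: add.assoc add.commute flip: single_add)
        have "?\<rho> b (Suc t) \<le> ?\<rho> b t + 1"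
          unfolding eq by (rule divisor_rank_add_frag_of[OF div q])
        then show "int t - ?\<rho> b t \<le> int (Suc t) - ?\<rho> b (Suc t)" by simp
      qed
      show "int t - ?\<rho> b t \<le> C0 - divisor_degree b" for t
        using lower[OF div, of "int t"] F(1)[OF b] q
        by (simp add: divisor_degree_add single_divisors divisor_degree_single)
    qed
  qed
  then obtain T c where Tc: "\<And>b t. b \<in> F \<Longrightarrow> t \<ge> T b \<Longrightarrow> int t - ?\<rho> b t = c b"
    by metis
  \<comment> \<open>A divisor of degree at least \<open>C\<close> has parameter
    \<open>t \<ge> T b\<close> for whichever \<open>b\<close> in \<open>F\<close> represents
    it.\<close>
  define C where "C = C0 + int (Max (insert 0 (T ` F)))"
  have T_le: "int (T b) \<le> int (Max (insert 0 (T ` F)))" if "b \<in> F" for b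
    using finF that by simp
  \<comment> \<open>\<open>X\<close> and \<open>X + s q\<close> lie on the same ray, with parameters
    \<open>t\<close> and \<open>t + s\<close>, both in the range where the difference is
    constant.\<close>
  have shift: "divisor_rank G (X + Poly_Mapping.single q s) = divisor_rank G X + s"
    if X: "X \<in> divisors G" "C \<le> divisor_degree X" and s: "0 \<le> s" for X s
  proof -
    obtain b where b: "b \<in> F" "principal (X - (b + Poly_Mapping.single q (?t X b)))"
      using reduce[OF X(1)] by blast
    define t where "t = nat (?t X b)"
    have t: "T b \<le> t" "int t = ?t X b"
      using X(2) F(3)[OF b(1)] T_le[OF b(1)] by (auto simp: C_def t_def)
    have eq: "X + Poly_Mapping.single q s - (b + Poly_Mapping.single q (int (t + nat s))) =
        X - (b + Poly_Mapping.single q (?t X b))"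
      unfolding t(2)[symmetric] using s by (simp add: single_add algebra_simps)
    have "divisor_rank G (X + Poly_Mapping.single q s) = ?\<rho> b (t + nat s)"
      by (intro divisor_rank_cong) (simp only: eq b(2))
    moreover have "divisor_rank G X = ?\<rho> b t"
      by (intro divisor_rank_cong) (simp only: t(2) b(2))
    ultimately show ?thesis
      using Tc[OF b(1) t(1)] Tc[OF b(1), of "t + nat s"] t(1) s by simp
  qed
  show ?thesis
  proof (rule that)
    show "0 < N" by (rule N)
    show "0 \<le> divisor_rank G X" if "X \<in> divisors G" "C \<le> divisor_degree X" for X
      using lower[OF that(1)] that(2) by (simp add: C_def)
    show "divisor_rank G (X + frag_cmul (int N) Y) = divisor_rank G X"
      if "X \<in> divisors G" "Y \<in> divisors G" "divisor_degree Y = 0" for X Y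
      using N(2)[OF that(2,3)] by (intro divisor_rank_cong) simp
    show "divisor_rank G (X + frag_cmul (int N) Y) = divisor_rank G X + int N * divisor_degree Y"
      if X: "X \<in> divisors G" and Y: "Y \<in> divisors G"
        and deg: "C \<le> divisor_degree X" "0 \<le> divisor_degree Y" for X Y
    proof -
      define W where "W = Y - Poly_Mapping.single q (divisor_degree Y)"
      have W: "W \<in> divisors G" "divisor_degree W = 0"
        using Y q by (simp_all add: W_def diff_divisors single_divisors divisor_degree_diff divisor_degree_single)
      have "X + frag_cmul (int N) Y - (X + Poly_Mapping.single q (int N * divisor_degree Y)) =
          frag_cmul (int N) W"
        by (intro poly_mapping_eqI) (simp add: W_def lookup_add lookup_minus lookup_single when_def
          right_diff_distrib)
      then have "divisor_rank G (X + frag_cmul (int N) Y) =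
          divisor_rank G (X + Poly_Mapping.single q (int N * divisor_degree Y))"
        using N(2)[OF W] by (intro divisor_rank_cong) simp
      also have "\<dots> = divisor_rank G X + int N * divisor_degree Y"
        using deg by (intro shift X) auto
      finally show ?thesis .
    qed
  qed
qed

end

section \<open>Rationality of the Poincare series\<close>

theorem theorem1:
  fixes G :: "('v, 'e) pre_digraph" and arev :: "'e \<Rightarrow> 'e"
    and D :: "'k::finite \<Rightarrow> ('v \<Rightarrow>\<^sub>0 int)"
  assumes "finite_connected_multigraph G arev"
    and "\<And>i. D i \<in> divisors G"
  shows "\<exists>f h :: 'k int_mpoly. \<forall>z :: complex ^ 'k.
           (\<lambda>n. norm (poincare_term G D z n)) summable_on UNIV \<longrightarrow>
             eval_int_mpoly h z \<noteq> 0 \<and>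
             poincare_series G D z = eval_int_mpoly f z / eval_int_mpoly h z"
proof -
  interpret finite_connected_multigraph G arev by (rule assms(1))
  obtain N C where N: "0 < N"
    and nonneg: "\<And>X. X \<in> divisors G \<Longrightarrow> C \<le> divisor_degree X \<Longrightarrow> 0 \<le> divisor_rank G X"
    and per: "\<And>X Y. X \<in> divisors G \<Longrightarrow> Y \<in> divisors G \<Longrightarrow> divisor_degree Y = 0 \<Longrightarrow>
      divisor_rank G (X + frag_cmul (int N) Y) = divisor_rank G X"
    and lin: "\<And>X Y. X \<in> divisors G \<Longrightarrow> Y \<in> divisors G \<Longrightarrow>
      C \<le> divisor_degree X \<Longrightarrow> 0 \<le> divisor_degree Y \<Longrightarrow>
      divisor_rank G (X + frag_cmul (int N) Y) = divisor_rank G X + int N * divisor_degree Y"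
    using divisor_rank_large_degree by blast
  define X where "X n = (\<Sum>i\<in>UNIV. frag_cmul (int (n i)) (D i))" for n :: "'k \<Rightarrow> nat"
  define d where "d i = divisor_degree (D i)" for i
  have X: "X n \<in> divisors G" for n
    unfolding X_def by (intro divisors_intros assms)
  have deg: "divisor_degree (X n) = (\<Sum>i\<in>UNIV. int (n i) * d i)" for n
    by (simp add: X_def d_def divisor_degree_sum divisor_degree_frag_cmul frag_cmul_divisors assms(2))
  \<comment> \<open>Brings shifts divisible by \<open>N\<close> into the form required by
    \<open>per\<close> and \<open>lin\<close>; the witness is the divisor belonging to
    \<open>u / N\<close>.\<close>
  have add: "\<exists>Y\<in>divisors G. X (\<lambda>i. n i + u i) = X n + frag_cmul (int N) Y \<and>
      (\<Sum>i\<in>UNIV. int (u i) * d i) = int N * divisor_degree Y"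
    if dvd: "\<And>i. N dvd u i" for n u
  proof (intro bexI conjI)
    let ?Y = "X (\<lambda>i. u i div N)"
    have u: "int (u i) = int N * int (u i div N)" for i
      using dvd[of i] by (metis dvd_mult_div_cancel of_nat_mult)
    show "X (\<lambda>i. n i + u i) = X n + frag_cmul (int N) ?Y"
      by (intro poly_mapping_eqI)
        (simp add: X_def lookup_add lookup_sum sum_distrib_left distrib_right sum.distrib u mult.assoc)
    show "(\<Sum>i\<in>UNIV. int (u i) * d i) = int N * divisor_degree ?Y"
      unfolding deg sum_distrib_left by (intro sum.cong refl) (metis u mult.assoc)
  qed (rule X)
  interpret quasilinear_series "\<lambda>n. divisor_rank G (X n) + 1" d N C
  proof
    show "0 < N" by (rule N)
    have "X (\<lambda>_. 0) = 0" by (simp add: X_def)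
    then show "divisor_rank G (X (\<lambda>_. 0)) + 1 \<noteq> 0" using divisor_rank_zero by simp
    show "divisor_rank G (X n) + 1 = 0" if "(\<Sum>i\<in>UNIV. int (n i) * d i) < 0" for n
      using divisor_rank_negative[OF X, of n] that by (simp add: deg)
    show "divisor_rank G (X n) + 1 \<noteq> 0" if "C \<le> (\<Sum>i\<in>UNIV. int (n i) * d i)" for n
      using nonneg[OF X, of n] that by (simp add: deg)
    show "divisor_rank G (X (\<lambda>i. n i + u i)) + 1 = divisor_rank G (X n) + 1"
      if u: "(\<Sum>i\<in>UNIV. int (u i) * d i) = 0" and dvd: "\<And>i. N dvd u i" for u n
    proof -
      obtain Y where Y: "Y \<in> divisors G" "X (\<lambda>i. n i + u i) = X n + frag_cmul (int N) Y"
        "(\<Sum>i\<in>UNIV. int (u i) * d i) = int N * divisor_degree Y"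
        using add[of u n, OF dvd] by blast
      then have "divisor_degree Y = 0" using u N by simp
      from per[OF X Y(1) this] show ?thesis by (simp only: Y(2))
    qed
    show "divisor_rank G (X (\<lambda>i. n i + u i)) + 1 =
        divisor_rank G (X n) + 1 + (\<Sum>i\<in>UNIV. int (u i) * d i)"
      if n: "C \<le> (\<Sum>i\<in>UNIV. int (n i) * d i)" and u: "0 \<le> (\<Sum>i\<in>UNIV. int (u i) * d i)"
        and dvd: "\<And>i. N dvd u i" for n u
    proof -
      obtain Y where Y: "Y \<in> divisors G" "X (\<lambda>i. n i + u i) = X n + frag_cmul (int N) Y"
        "(\<Sum>i\<in>UNIV. int (u i) * d i) = int N * divisor_degree Y"
        using add[of u n, OF dvd] by blast
      then have "0 \<le> divisor_degree Y" using u N by (simp add: zero_le_mult_iff)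
      from lin[OF X Y(1) n[folded deg] this] show ?thesis by (simp only: Y(2,3))
    qed
  qed
  have term_eq: "poincare_term G D z n = summand z n" for z n
    by (simp add: poincare_term_def summand_def monomial_at_def flip: X_def)
  have "orthant UNIV (\<lambda>_. 0) = (UNIV :: ('k \<Rightarrow> nat) set)"
    by (simp add: orthant_def)
  then have series_eq: "poincare_series G D z = partial_series UNIV (\<lambda>_. 0) z" for z
    by (simp add: poincare_series_def partial_series_def term_eq)
  show ?thesis
    using partial_series_rational[of UNIV "\<lambda>_. 0"]
    unfolding rational_on_def Z_def term_eq series_eq by blast
qed

end
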